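(* Let $f,h:\mathbb{R}^d\to\mathbb{R}$ be differentiable with $\nabla f$ Lipschitz continuous with constant $L_f$ and $\nabla h$ Lipschitz continuous with constant $L_h$, let $g:\mathbb{R}^d\to\mathbb{R}\cup\{+\infty\}$ be proper, lower semicontinuous and prox-bounded with threshold $\gamma_g>0$, and suppose that $\varphi:=f+g+h$ has a nonempty set of minimisers. Let $\alpha\in(0,1)$ and $\lambda>0$ be such that $\lambda\alpha<2$, and let $x^0\in\mathbb{R}^d$. Then, for all sufficiently small $\gamma>0$, there exists $c>0$ such that every damped shadow Davis-Yin sequence $(x^k)$ generated from $x^0$ with parameters $(\gamma,\alpha,\lambda)$ satisfies, for all $k\ge1$, $$\varphi_\gamma^{\rm DY}(x^{k+1})+\frac{c}{\gamma}\|x^{k+1}-x^k\|^2\le\varphi_\gamma^{\rm DY}(x^k).$$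
   Context: A function $g$ is prox-bounded with threshold $\gamma_g>0$ if $g+\frac{1}{2\gamma_g}\|\cdot\|^2$ is bounded from below. The proximal operator is $\mathrm{prox}_{\gamma\phi}(x):=\mathrm{argmin}_{y\in\mathbb{R}^d}\{\phi(y)+\frac1{2\gamma}\|y-x\|^2\}$, possibly set-valued. Damped shadow Davis-Yin method with stepsize $\gamma>0$, damping parameter $\alpha\in(0,1)$, relaxation parameter $\lambda>0$ and starting point $x^0$: iterate $$y^k\in\mathrm{prox}_{\gamma g}\big(x^k-\gamma\nabla(f+h)(x^k)\big),\qquad x^{k+1}=(1-\alpha)x^k+\alpha\,\mathrm{prox}_{\gamma f}\big((1-\lambda)x^k+\gamma\nabla f(x^k)+\lambda y^k\big),$$ for $k\ge0$, where $y^k$ is any selection of the proximal operator. (For all small $\gamma$, $\mathrm{prox}_{\gamma f}$ is single-valued and $\mathrm{prox}_{\gamma g}$ is nonempty-valued.) For $\gamma>0$ the Davis-Yin envelope is $$\varphi_\gamma^{\rm DY}(x):=\inf_{y\in\mathbb{R}^d}\Big\{f(x)+\langle\nabla f(x),y-x\rangle+h(x)+\langle\nabla h(x),y-x\rangle+g(y)+\frac{1}{2\gamma}\|y-x\|^2\Big\}.$$ *)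

theory Defs
  imports "HOL-Analysis.Analysis"
begin

text \<open>Functions with values in \<open>\<real> \<union> {+\<infinity>}\<close> are functions into \<^typ>\<open>ereal\<close>; the value \<open>-\<infinity>\<close>
  is excluded by properness.\<close>

definition proper_fun :: "('a \<Rightarrow> ereal) \<Rightarrow> bool" where
  "proper_fun g \<longleftrightarrow> (\<forall>x. g x \<noteq> -\<infinity>) \<and> (\<exists>x. g x \<noteq> \<infinity>)"

definition lower_semicontinuous :: "('a::topological_space \<Rightarrow> ereal) \<Rightarrow> bool" where
  "lower_semicontinuous g \<longleftrightarrow> (\<forall>x. g x \<le> Liminf (at x) g)"

definition prox_bounded :: "real \<Rightarrow> ('a::real_normed_vector \<Rightarrow> ereal) \<Rightarrow> bool" where
  "prox_bounded \<gamma> g \<longleftrightarrow>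
     \<gamma> > 0 \<and> (\<exists>m::real. \<forall>x. ereal m \<le> g x + ereal (1 / (2 * \<gamma>) * (norm x)\<^sup>2))"

text \<open>Meaningful only at points of differentiability, where the gradient is unique.\<close>

definition gradient :: "('a::real_inner \<Rightarrow> real) \<Rightarrow> 'a \<Rightarrow> 'a" where
  "gradient f x = (THE D. GDERIV f x :> D)"

definition argmin_set :: "('a \<Rightarrow> ereal) \<Rightarrow> 'a set" where
  "argmin_set \<phi> = {x. is_arg_min \<phi> (\<lambda>_. True) x}"

definition prox :: "real \<Rightarrow> ('a::real_normed_vector \<Rightarrow> ereal) \<Rightarrow> 'a \<Rightarrow> 'a set" where
  "prox \<gamma> \<phi> x = argmin_set (\<lambda>y. \<phi> y + ereal (1 / (2 * \<gamma>) * (norm (y - x))\<^sup>2))"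

text \<open>The proximal operator of \<open>f\<close> is set-valued here, so its value in the update is rendered as a
  selection \<open>z\<close>. If \<open>\<nabla>f\<close> is \<open>L\<close>-Lipschitz and \<open>\<gamma> * L < 1\<close>, the set is a singleton and \<open>z\<close> is
  uniquely determined.\<close>

definition damped_shadow_DY ::
  "('a::real_inner \<Rightarrow> real) \<Rightarrow> ('a \<Rightarrow> ereal) \<Rightarrow> ('a \<Rightarrow> real) \<Rightarrow> real \<Rightarrow> real \<Rightarrow> real \<Rightarrow> 'a \<Rightarrow>
   (nat \<Rightarrow> 'a) \<Rightarrow> bool" where
  "damped_shadow_DY f g h \<gamma> \<alpha> lam x0 x \<longleftrightarrow>
     x 0 = x0 \<and>
     (\<exists>y. \<forall>k.
        y k \<in> prox \<gamma> g (x k - \<gamma> *\<^sub>R gradient (\<lambda>u. f u + h u) (x k)) \<and>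
        (\<exists>z \<in> prox \<gamma> (\<lambda>u. ereal (f u))
                ((1 - lam) *\<^sub>R x k + \<gamma> *\<^sub>R gradient f (x k) + lam *\<^sub>R y k).
           x (Suc k) = (1 - \<alpha>) *\<^sub>R x k + \<alpha> *\<^sub>R z))"

definition DY_envelope ::
  "('a::real_inner \<Rightarrow> real) \<Rightarrow> ('a \<Rightarrow> ereal) \<Rightarrow> ('a \<Rightarrow> real) \<Rightarrow> real \<Rightarrow> 'a \<Rightarrow> ereal" where
  "DY_envelope f g h \<gamma> x =
     (INF y. ereal (f x + gradient f x \<bullet> (y - x) + h x + gradient h x \<bullet> (y - x)) + g y
             + ereal (1 / (2 * \<gamma>) * (norm (y - x))\<^sup>2))"

end

theory Submission
  imports Defs
begin

text \<open>The point \<open>y\<^sup>k\<close> attains the infimum defining the envelope at \<open>x\<^sup>k\<close> and is admissible in the infimum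
  at \<open>x\<^sup>k\<^sup>+\<^sup>1\<close>, so it suffices to compare the two forward models at \<open>y\<^sup>k\<close>. Up to terms of order
  \<open>\<parallel>s\<parallel>\<^sup>2\<close> in the step \<open>s = x\<^sup>k\<^sup>+\<^sup>1 - x\<^sup>k\<close>, their difference is that of the quadratic terms,
  \<open>(\<parallel>s\<parallel>\<^sup>2 - 2 \<langle>y\<^sup>k - x\<^sup>k, s\<rangle>) / (2 \<gamma>)\<close>. The optimality condition of \<open>prox\<^sub>f\<close> gives
  \<open>y\<^sup>k - x\<^sup>k = s / (lam \<alpha>) + O(\<gamma> \<parallel>s\<parallel>)\<close>, and \<open>lam \<alpha> < 2\<close> makes the leading coefficient
  \<open>(1/2 - 1/(lam \<alpha>)) / \<gamma>\<close> negative.\<close>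

lemma gradient_eqI:
  assumes "GDERIV f x :> D"
  shows "gradient f x = D"
  unfolding gradient_def
proof (rule the_equality)
  show "GDERIV f x :> D" by (fact assms)
next
  fix D' assume "GDERIV f x :> D'"
  with assms have "(\<lambda>h. h \<bullet> D') = (\<lambda>h. h \<bullet> D)"
    unfolding gderiv_def by (rule has_derivative_unique[rotated])
  then have "u \<bullet> (D' - D) = 0" for u
    by (metis inner_diff_right eq_iff_diff_eq_0)
  then have "(D' - D) \<bullet> (D' - D) = 0" .
  then show "D' = D" by simp
qed

text \<open>In finite dimension the derivative is a linear functional, hence an inner product with a
  fixed vector, here \<open>adjoint f' 1\<close>. This supplies the existence behind the definite
  description in \<open>gradient\<close>.\<close>

lemma GDERIV_gradient:
  fixes f :: "'a::euclidean_space \<Rightarrow> real"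
  assumes "f differentiable at x"
  shows "GDERIV f x :> gradient f x"
proof -
  obtain f' where f': "(f has_derivative f') (at x)"
    using assms by (auto simp: differentiable_def)
  then have "linear f'" by (rule has_derivative_linear)
  then have "f' = (\<lambda>h. h \<bullet> adjoint f' 1)"
    by (auto simp: adjoint_works)
  with f' have "GDERIV f x :> adjoint f' 1"
    by (simp add: gderiv_def)
  then show ?thesis by (simp add: gradient_eqI)
qed

text \<open>By the mean value theorem on the segment from \<open>x\<close> to \<open>y\<close>, the
  increment of \<open>F\<close> is given by the gradient at an intermediate point, which is within
  \<open>L * norm (y - x)\<close> of \<open>G x\<close>. The constant \<open>L\<close>, in place of
  the sharp \<open>L / 2\<close>, only enters a term that stays bounded as \<gamma> tends to
  0.\<close>

lemma lipschitz_gradient_upper_bound: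
  fixes F :: "'a::real_inner \<Rightarrow> real"
  assumes deriv: "\<And>u. GDERIV F u :> G u" and lip: "L-lipschitz_on UNIV G"
  shows "F y \<le> F x + G x \<bullet> (y - x) + L * (norm (y - x))\<^sup>2"
proof -
  let ?p = "\<lambda>t. x + t *\<^sub>R (y - x)"
  have "((\<lambda>t. F (?p t)) has_derivative (\<lambda>h. (h *\<^sub>R (y - x)) \<bullet> G (?p t))) (at t within {0..1})" for t
    by (rule has_derivative_compose[where f = ?p and g = F, OF _ deriv[unfolded gderiv_def]])
      (auto intro!: derivative_eq_intros)
  then obtain t where t: "t \<in> {0..1}" and eq: "F (?p 1) - F (?p 0) = ((1 - 0) *\<^sub>R (y - x)) \<bullet> G (?p t)"
    using mvt_very_simple[of 0 1 "\<lambda>t. F (?p t)" "\<lambda>t h. (h *\<^sub>R (y - x)) \<bullet> G (?p t)"] by auto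
  have "F y - F x - G x \<bullet> (y - x) = (y - x) \<bullet> (G (?p t) - G x)"
    using eq by (simp add: inner_diff_right inner_commute)
  also have "\<dots> \<le> norm (y - x) * norm (G (?p t) - G x)"
    by (rule norm_cauchy_schwarz)
  also have "\<dots> \<le> norm (y - x) * (L * norm (y - x))"
  proof (rule mult_left_mono)
    have "norm (G (?p t) - G x) \<le> L * (t * norm (y - x))"
      using lipschitz_onD[OF lip, of "?p t" x] t by (simp add: dist_norm)
    also have "\<dots> \<le> L * norm (y - x)"
      using t lipschitz_on_nonneg[OF lip] by (intro mult_left_mono mult_left_le_one_le) auto
    finally show "norm (G (?p t) - G x) \<le> L * norm (y - x)" .
  qed simp
  finally show ?thesis
    by (simp add: power2_eq_square algebra_simps)
qed

text \<open>Moving the base point from \<open>x\<close> to \<open>x'\<close> costs \<open>L\<close>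
  in the linearisation of \<open>F\<close> and \<open>L * (M + 1)\<close> in replacing
  \<open>G x'\<close> by \<open>G x\<close>, each times the squared step. Expanding the square gains
  \<open>(K - 1 / 2) / \<gamma>\<close>, as \<open>K\<close> bounds the inner product of
  \<open>y - x\<close> with the step from below.\<close>

lemma forward_model_descent:
  fixes F :: "'a::real_inner \<Rightarrow> real"
  assumes deriv: "\<And>u. GDERIV F u :> G u" and lip: "L-lipschitz_on UNIV G" and "\<gamma> > 0"
    and M: "norm (y - x) \<le> M * norm (x' - x)"
    and K: "K * (norm (x' - x))\<^sup>2 \<le> (y - x) \<bullet> (x' - x)"
  shows "F x' + G x' \<bullet> (y - x') + (norm (y - x'))\<^sup>2 / (2 * \<gamma>)
           + ((K - 1 / 2) / \<gamma> - L * (2 + M)) * (norm (x' - x))\<^sup>2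
         \<le> F x + G x \<bullet> (y - x) + (norm (y - x))\<^sup>2 / (2 * \<gamma>)"
proof -
  define s p where "s = x' - x" and "p = y - x"
  have y_x': "y - x' = p - s" by (simp add: s_def p_def)
  have F: "F x' \<le> F x + G x \<bullet> s + L * (norm s)\<^sup>2"
    using lipschitz_gradient_upper_bound[OF deriv lip, of x' x] by (simp add: s_def)
  have "(G x' - G x) \<bullet> (p - s) \<le> norm (G x' - G x) * norm (p - s)"
    by (rule norm_cauchy_schwarz)
  also have "\<dots> \<le> (L * norm s) * ((M + 1) * norm s)"
  proof (rule mult_mono)
    show "norm (G x' - G x) \<le> L * norm s"
      using lipschitz_onD[OF lip, of x' x] by (simp add: dist_norm s_def)
    show "norm (p - s) \<le> (M + 1) * norm s"
      using norm_triangle_ineq4[of p s] M by (simp add: s_def p_def algebra_simps)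
  qed (use lipschitz_on_nonneg[OF lip] in auto)
  finally have cross: "(G x' - G x) \<bullet> (p - s) \<le> L * (M + 1) * (norm s)\<^sup>2"
    by (simp add: power2_eq_square algebra_simps)
  have "(norm (p - s))\<^sup>2 = (norm p)\<^sup>2 - 2 * (p \<bullet> s) + (norm s)\<^sup>2"
    by (simp add: power2_norm_eq_inner inner_diff_left inner_diff_right inner_commute)
  also have "\<dots> \<le> (norm p)\<^sup>2 - 2 * (K - 1 / 2) * (norm s)\<^sup>2"
    using K by (simp add: s_def p_def algebra_simps)
  finally have "(norm (p - s))\<^sup>2 / (2 * \<gamma>) \<le> ((norm p)\<^sup>2 - 2 * (K - 1 / 2) * (norm s)\<^sup>2) / (2 * \<gamma>)"
    using \<open>\<gamma> > 0\<close> by (intro divide_right_mono) auto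
  also have "\<dots> = (norm p)\<^sup>2 / (2 * \<gamma>) - (K - 1 / 2) / \<gamma> * (norm s)\<^sup>2"
    using \<open>\<gamma> > 0\<close> by (simp add: field_simps)
  finally have quad: "(norm (p - s))\<^sup>2 / (2 * \<gamma>) \<le> (norm p)\<^sup>2 / (2 * \<gamma>) - (K - 1 / 2) / \<gamma> * (norm s)\<^sup>2" .
  show ?thesis
    using F cross quad unfolding y_x' s_def[symmetric] p_def[symmetric]
    by (simp add: algebra_simps inner_diff_left inner_diff_right)
qed

lemma prox_le:
  assumes "z \<in> prox \<gamma> \<phi> w"
  shows "\<phi> z + ereal (1 / (2 * \<gamma>) * (norm (z - w))\<^sup>2) \<le> \<phi> u + ereal (1 / (2 * \<gamma>) * (norm (u - w))\<^sup>2)"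
  using assms by (simp add: prox_def argmin_set_def is_arg_min_linorder)

text \<open>Fermat's rule: the proximal objective is differentiable at its minimiser
  \<open>z\<close>, so its derivative vanishes there.\<close>

lemma prox_optimality:
  fixes f :: "'a::real_inner \<Rightarrow> real"
  assumes z: "z \<in> prox \<gamma> (\<lambda>u. ereal (f u)) w" and deriv: "GDERIV f z :> D" and "\<gamma> > 0"
  shows "z + \<gamma> *\<^sub>R D = w"
proof -
  have "((\<lambda>u. f u + 1 / (2 * \<gamma>) * (norm (u - w))\<^sup>2) has_derivative
      (\<lambda>h. h \<bullet> D + 1 / (2 * \<gamma>) * (2 * (h \<bullet> (z - w))))) (at z)"
    using deriv \<open>\<gamma> > 0\<close> unfolding gderiv_def power2_norm_eq_inner
    by (auto intro!: derivative_eq_intros simp: inner_commute)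
  moreover have "\<forall>\<^sub>F u in at z. f z + 1 / (2 * \<gamma>) * (norm (z - w))\<^sup>2 \<le> f u + 1 / (2 * \<gamma>) * (norm (u - w))\<^sup>2"
    using prox_le[OF z] by simp
  ultimately have "(\<lambda>h. h \<bullet> D + 1 / (2 * \<gamma>) * (2 * (h \<bullet> (z - w)))) = (\<lambda>h. 0)"
    by (rule has_derivative_local_min)
  then have "h \<bullet> D + 1 / (2 * \<gamma>) * (2 * (h \<bullet> (z - w))) = 0" for h
    by metis
  \<comment> \<open>Testing the vanishing derivative in the direction of the residual itself makes
    the squared norm of the residual zero.\<close>
  from this[of "z + \<gamma> *\<^sub>R D - w"] have "(z + \<gamma> *\<^sub>R D - w) \<bullet> (\<gamma> *\<^sub>R D + (z - w)) = 0"
    using \<open>\<gamma> > 0\<close> by (simp only: inner_add_right inner_scaleR_right) (simp add: field_simps)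
  also have "\<gamma> *\<^sub>R D + (z - w) = z + \<gamma> *\<^sub>R D - w"
    by simp
  finally show ?thesis by simp
qed

text \<open>Completing the square: the objective of the envelope and that of the proximal step at
  the forward point differ by a quantity independent of the variable, so they have the same
  minimisers.\<close>

lemma DY_envelope_attained:
  fixes x :: "'a::real_inner"
  assumes y: "y \<in> prox \<gamma> g (x - \<gamma> *\<^sub>R (gradient f x + gradient h x))" and "\<gamma> > 0"
  shows "DY_envelope f g h \<gamma> x =
     ereal (f x + gradient f x \<bullet> (y - x) + h x + gradient h x \<bullet> (y - x)) + g y
             + ereal (1 / (2 * \<gamma>) * (norm (y - x))\<^sup>2)"
proof -
  define D where "D = gradient f x + gradient h x"
  have square: "1 / (2 * \<gamma>) * (norm (u - (x - \<gamma> *\<^sub>R D)))\<^sup>2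
      = 1 / (2 * \<gamma>) * (norm (u - x))\<^sup>2 + D \<bullet> (u - x) + \<gamma> / 2 * (D \<bullet> D)" for u
  proof -
    have "(norm (u - (x - \<gamma> *\<^sub>R D)))\<^sup>2 = (norm ((u - x) + \<gamma> *\<^sub>R D))\<^sup>2"
      by (simp add: algebra_simps)
    also have "\<dots> = (norm (u - x))\<^sup>2 + 2 * \<gamma> * (D \<bullet> (u - x)) + \<gamma>\<^sup>2 * (D \<bullet> D)"
      unfolding power2_norm_eq_inner inner_add_left inner_add_right
      by (simp add: power2_eq_square inner_commute)
    finally show ?thesis
      using \<open>\<gamma> > 0\<close> by (simp add: field_simps power2_eq_square)
  qed
  \<comment> \<open>Cancelling the common constant is legitimate only between finite terms, hence
    the case split on the values of \<open>g\<close>.\<close>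
  have "ereal (f x + gradient f x \<bullet> (y - x) + h x + gradient h x \<bullet> (y - x)) + g y
             + ereal (1 / (2 * \<gamma>) * (norm (y - x))\<^sup>2)
      \<le> ereal (f x + gradient f x \<bullet> (u - x) + h x + gradient h x \<bullet> (u - x)) + g u
             + ereal (1 / (2 * \<gamma>) * (norm (u - x))\<^sup>2)" for u
    using prox_le[OF y, of u, folded D_def, unfolded square]
    by (cases "g y"; cases "g u") (auto simp: D_def inner_add_left)
  then show ?thesis
    unfolding DY_envelope_def by (intro antisym INF_lower INF_greatest) auto
qed

text \<open>With \<open>d = z - x\<close> and \<open>e = G z - G x\<close>, optimality of
  \<open>z\<close> reads \<open>lam *\<^sub>R (y - x) = d + \<gamma> *\<^sub>R e\<close>, where
  \<open>e\<close> is at most \<open>L * norm d\<close> in norm. Since the step is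
  \<open>\<alpha> *\<^sub>R d\<close>, this makes \<open>y - x\<close> the step divided by
  \<open>lam * \<alpha>\<close>, up to a relative error \<open>\<gamma> * L\<close>.\<close>

lemma shadow_step_bounds:
  fixes f :: "'a::real_inner \<Rightarrow> real"
  assumes deriv: "\<And>u. GDERIV f u :> G u" and lip: "L-lipschitz_on UNIV G"
    and "\<gamma> > 0" "\<alpha> > 0" "lam > 0"
    and z: "z \<in> prox \<gamma> (\<lambda>u. ereal (f u)) ((1 - lam) *\<^sub>R x + \<gamma> *\<^sub>R G x + lam *\<^sub>R y)"
    and x': "x' = (1 - \<alpha>) *\<^sub>R x + \<alpha> *\<^sub>R z"
  shows "norm (y - x) \<le> (1 + \<gamma> * L) / (lam * \<alpha>) * norm (x' - x)"
    and "(1 - \<gamma> * L) / (lam * \<alpha>) * (norm (x' - x))\<^sup>2 \<le> (y - x) \<bullet> (x' - x)"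
proof -
  define d e where "d = z - x" and "e = G z - G x"
  have step: "x' - x = \<alpha> *\<^sub>R d"
    by (simp add: x' d_def algebra_simps)
  have "z + \<gamma> *\<^sub>R G z = (1 - lam) *\<^sub>R x + \<gamma> *\<^sub>R G x + lam *\<^sub>R y"
    using prox_optimality[OF z deriv \<open>\<gamma> > 0\<close>] .
  then have "lam *\<^sub>R (y - x) = d + \<gamma> *\<^sub>R e"
    by (simp add: d_def e_def algebra_simps)
  then have p: "y - x = (1 / lam) *\<^sub>R (d + \<gamma> *\<^sub>R e)"
    using \<open>lam > 0\<close> by (metis divide_inverse mult_1 scaleR_scaleR left_inverse scaleR_one less_irrefl)
  have e: "norm e \<le> L * norm d"
    using lipschitz_onD[OF lip, of z x] by (simp add: dist_norm d_def e_def)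
  have "norm (y - x) = norm (d + \<gamma> *\<^sub>R e) / lam"
    using \<open>lam > 0\<close> by (simp only: p norm_scaleR) simp
  also have "norm (d + \<gamma> *\<^sub>R e) \<le> norm d + \<gamma> * norm e"
    using norm_triangle_ineq[of d "\<gamma> *\<^sub>R e"] \<open>\<gamma> > 0\<close> by simp
  also have "norm d + \<gamma> * norm e \<le> (1 + \<gamma> * L) * norm d"
    using e \<open>\<gamma> > 0\<close> by (simp add: algebra_simps)
  finally have "norm (y - x) \<le> (1 + \<gamma> * L) * norm d / lam"
    using \<open>lam > 0\<close> by (simp add: divide_right_mono)
  then show "norm (y - x) \<le> (1 + \<gamma> * L) / (lam * \<alpha>) * norm (x' - x)"
    using \<open>\<alpha> > 0\<close> by (simp add: step)
  have "- (e \<bullet> d) \<le> norm e * norm d"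
    using Cauchy_Schwarz_ineq2[of e d] by linarith
  also have "\<dots> \<le> L * norm d * norm d"
    using e by (intro mult_right_mono) auto
  finally have "- (\<gamma> * (e \<bullet> d)) \<le> \<gamma> * (L * (norm d)\<^sup>2)"
    using \<open>\<gamma> > 0\<close> mult_left_mono[of "- (e \<bullet> d)" "L * norm d * norm d" \<gamma>]
    by (simp add: power2_eq_square mult.assoc)
  then have "(1 - \<gamma> * L) * (norm d)\<^sup>2 \<le> (d + \<gamma> *\<^sub>R e) \<bullet> d"
    by (simp add: inner_add_left power2_norm_eq_inner algebra_simps)
  \<comment> \<open>The factor \<alpha> comes from the step and \<open>1 / lam\<close> from
    \<open>y - x\<close>.\<close>
  then have "\<alpha> / lam * ((1 - \<gamma> * L) * (norm d)\<^sup>2) \<le> \<alpha> / lam * ((d + \<gamma> *\<^sub>R e) \<bullet> d)"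
    using \<open>\<alpha> > 0\<close> \<open>lam > 0\<close> by (intro mult_left_mono) auto
  moreover have "(1 - \<gamma> * L) / (lam * \<alpha>) * (norm (x' - x))\<^sup>2 = \<alpha> / lam * ((1 - \<gamma> * L) * (norm d)\<^sup>2)"
    using \<open>\<alpha> > 0\<close> \<open>lam > 0\<close> by (simp add: step power_mult_distrib power2_eq_square)
  moreover have "(y - x) \<bullet> (x' - x) = \<alpha> / lam * ((d + \<gamma> *\<^sub>R e) \<bullet> d)"
    by (simp add: p step)
  ultimately show "(1 - \<gamma> * L) / (lam * \<alpha>) * (norm (x' - x))\<^sup>2 \<le> (y - x) \<bullet> (x' - x)"
    by simp
qed

theorem theorem2:
  fixes f h :: "real ^ 'n \<Rightarrow> real"
    and g :: "real ^ 'n \<Rightarrow> ereal"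
    and L\<^sub>f L\<^sub>h \<gamma>\<^sub>g \<alpha> lam :: real
    and x0 :: "real ^ 'n"
  assumes "f differentiable_on UNIV"
    and "L\<^sub>f-lipschitz_on UNIV (gradient f)"
    and "h differentiable_on UNIV"
    and "L\<^sub>h-lipschitz_on UNIV (gradient h)"
    and "proper_fun g"
    and "lower_semicontinuous g"
    and "prox_bounded \<gamma>\<^sub>g g"
    and "argmin_set (\<lambda>x. ereal (f x) + g x + ereal (h x)) \<noteq> {}"
    and "0 < \<alpha>" and "\<alpha> < 1"
    and "0 < lam" and "lam * \<alpha> < 2"
  shows "\<exists>\<gamma>0>0. \<forall>\<gamma>. 0 < \<gamma> \<and> \<gamma> < \<gamma>0 \<longrightarrow>
           (\<exists>c>0. \<forall>x. damped_shadow_DY f g h \<gamma> \<alpha> lam x0 x \<longrightarrow>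
              (\<forall>k\<ge>1. DY_envelope f g h \<gamma> (x (Suc k)) + ereal (c / \<gamma> * (norm (x (Suc k) - x k))\<^sup>2)
                      \<le> DY_envelope f g h \<gamma> (x k)))"
proof -
  have df: "GDERIV f u :> gradient f u" and dh: "GDERIV h u :> gradient h u" for u
    using assms(1,3) by (auto intro!: GDERIV_gradient simp: differentiable_on_def)
  then have dF: "GDERIV (\<lambda>u. f u + h u) u :> gradient f u + gradient h u" for u
    by (intro GDERIV_add)
  have lipF: "(L\<^sub>f + L\<^sub>h)-lipschitz_on UNIV (\<lambda>u. gradient f u + gradient h u)"
    using assms(2,4) by (rule lipschitz_on_add)
  have nonneg: "L\<^sub>f \<ge> 0" "L\<^sub>h \<ge> 0"
    using assms(2,4) by (auto dest: lipschitz_on_nonneg)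
  have la: "lam * \<alpha> > 0"
    using assms by simp
  \<comment> \<open>Half of the leading gain \<open>1 / (lam * \<alpha>) - 1 / 2\<close>; the other
    half will absorb the error terms.\<close>
  define c where "c = (1 / (lam * \<alpha>) - 1 / 2) / 2"
  \<comment> \<open>A bound, uniform in \<gamma> up to 1, on the errors that are not divided by
    \<gamma>: the first summand is the loss in the lower bound on the inner product, the second the
    loss in the forward model.\<close>
  define C where "C = L\<^sub>f / (lam * \<alpha>) + (L\<^sub>f + L\<^sub>h) * (2 + (1 + L\<^sub>f) / (lam * \<alpha>))"
  have "c > 0"
    using la \<open>lam * \<alpha> < 2\<close> by (simp add: c_def field_simps)
  have "C \<ge> 0"
    using nonneg la by (simp add: C_def)
  \<comment> \<open>The bound 1 on \<gamma> justifies \<open>C\<close>, and the other bound gives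
    \<open>\<gamma> * (C + 1) \<le> c\<close>, so the errors use up at most half of the gain. Adding
    1 to \<open>C\<close> keeps the denominator positive.\<close>
  have descent: "DY_envelope f g h \<gamma> (x (Suc k)) + ereal (c / \<gamma> * (norm (x (Suc k) - x k))\<^sup>2)
      \<le> DY_envelope f g h \<gamma> (x k)"
    if \<gamma>: "0 < \<gamma>" "\<gamma> < min 1 (c / (C + 1))" and x: "damped_shadow_DY f g h \<gamma> \<alpha> lam x0 x" for \<gamma> x k
  proof -
    obtain y z where y: "y \<in> prox \<gamma> g (x k - \<gamma> *\<^sub>R (gradient f (x k) + gradient h (x k)))"
      and z: "z \<in> prox \<gamma> (\<lambda>u. ereal (f u)) ((1 - lam) *\<^sub>R x k + \<gamma> *\<^sub>R gradient f (x k) + lam *\<^sub>R y)"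
      and x': "x (Suc k) = (1 - \<alpha>) *\<^sub>R x k + \<alpha> *\<^sub>R z"
      using x unfolding damped_shadow_DY_def gradient_eqI[OF dF] by blast
    let ?M = "(1 + \<gamma> * L\<^sub>f) / (lam * \<alpha>)" and ?K = "(1 - \<gamma> * L\<^sub>f) / (lam * \<alpha>)"
    note bounds = shadow_step_bounds[OF df assms(2) \<gamma>(1) \<open>0 < \<alpha>\<close> \<open>0 < lam\<close> z x']
    note model = forward_model_descent[OF dF lipF \<gamma>(1) bounds]
    have coeff: "c / \<gamma> \<le> (?K - 1 / 2) / \<gamma> - (L\<^sub>f + L\<^sub>h) * (2 + ?M)"
    proof -
      have "\<gamma> * L\<^sub>f \<le> L\<^sub>f"
        using \<gamma> nonneg by (intro mult_left_le_one_le) auto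
      then have "?M \<le> (1 + L\<^sub>f) / (lam * \<alpha>)"
        using la by (intro divide_right_mono) auto
      then have "(L\<^sub>f + L\<^sub>h) * (2 + ?M) \<le> (L\<^sub>f + L\<^sub>h) * (2 + (1 + L\<^sub>f) / (lam * \<alpha>))"
        using nonneg by (intro mult_left_mono) auto
      then have "\<gamma> * (L\<^sub>f / (lam * \<alpha>) + (L\<^sub>f + L\<^sub>h) * (2 + ?M)) \<le> \<gamma> * (C + 1)"
        using \<gamma> by (intro mult_left_mono) (auto simp: C_def)
      also have "\<dots> \<le> c"
        using \<gamma> \<open>C \<ge> 0\<close> by (simp add: field_simps)
      finally have "\<gamma> * (L\<^sub>f / (lam * \<alpha>)) + \<gamma> * ((L\<^sub>f + L\<^sub>h) * (2 + ?M)) \<le> c"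
        by (simp only: distrib_left[of \<gamma>])
      moreover have "?K = 2 * c + 1 / 2 - \<gamma> * (L\<^sub>f / (lam * \<alpha>))"
        by (simp add: c_def diff_divide_distrib)
      \<comment> \<open>The nonlinear products are abstracted to variables, which leaves a purely
        linear implication.\<close>
      moreover have "a + b \<le> c \<Longrightarrow> K = 2 * c + 1 / 2 - a \<Longrightarrow> c \<le> K - 1 / 2 - b" for a b K
        by linarith
      ultimately have "c \<le> ?K - 1 / 2 - \<gamma> * ((L\<^sub>f + L\<^sub>h) * (2 + ?M))"
        by blast
      then have "c / \<gamma> \<le> (?K - 1 / 2 - \<gamma> * ((L\<^sub>f + L\<^sub>h) * (2 + ?M))) / \<gamma>"
        using \<gamma> by (intro divide_right_mono) auto
      then show ?thesis
        using \<gamma> by (simp add: diff_divide_distrib)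
    qed
    have "DY_envelope f g h \<gamma> (x (Suc k)) \<le>
        ereal (f (x (Suc k)) + gradient f (x (Suc k)) \<bullet> (y - x (Suc k)) + h (x (Suc k))
               + gradient h (x (Suc k)) \<bullet> (y - x (Suc k))) + g y
             + ereal (1 / (2 * \<gamma>) * (norm (y - x (Suc k)))\<^sup>2)"
      unfolding DY_envelope_def by (rule INF_lower) simp
    then have "DY_envelope f g h \<gamma> (x (Suc k)) + ereal (c / \<gamma> * (norm (x (Suc k) - x k))\<^sup>2)
        \<le> ereal (f (x (Suc k)) + gradient f (x (Suc k)) \<bullet> (y - x (Suc k)) + h (x (Suc k))
               + gradient h (x (Suc k)) \<bullet> (y - x (Suc k))) + g y
             + ereal (1 / (2 * \<gamma>) * (norm (y - x (Suc k)))\<^sup>2)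
             + ereal (c / \<gamma> * (norm (x (Suc k) - x k))\<^sup>2)"
      by (rule add_right_mono)
    \<comment> \<open>Both sides contain the same summand \<open>g y\<close>, so for finite
      \<open>g y\<close> the claim is the real inequality between the forward models of
      \<open>f + h\<close>, weakened by \<open>coeff\<close>; the infinite cases are
      immediate.\<close>
    also have "\<dots> \<le> DY_envelope f g h \<gamma> (x k)"
      unfolding DY_envelope_attained[OF y \<gamma>(1)]
      using model mult_right_mono[OF coeff zero_le_power2[of "norm (x (Suc k) - x k)"]]
      by (cases "g y") (auto simp: inner_add_left)
    finally show ?thesis .
  qed
  have "min 1 (c / (C + 1)) > 0"
    using \<open>c > 0\<close> \<open>C \<ge> 0\<close> by simp
  then show ?thesis
    using descent \<open>c > 0\<close> by blast
qed

end
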